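(* Let $\boldsymbol{\Gamma}$ be a pointclass and $E$ an equivalence relation on a Polish space $X$. If $(\boldsymbol{\Gamma},E)$-determinacy holds, then $(\boldsymbol{\Gamma},E,T)$-determinacy holds for every pruned tree $T\subseteq\omega^{<\omega}$.
   Context: A pointclass is a collection of subsets of Polish spaces closed under continuous preimages. $(\boldsymbol{\Gamma},E)$-determinacy means: for every continuous surjection $\pi:\omega^\omega\to X$ and every $E$-invariant set $A\subseteq X$ in $\boldsymbol{\Gamma}$, the set $\pi^{-1}(A)\subseteq\omega^\omega$ is determined (Gale–Stewart game where players alternately play natural numbers). A tree $T\subseteq\omega^{<\omega}$ is pruned if it has no terminal nodes; $[T]$ is its set of infinite branches. $(\boldsymbol{\Gamma},E,T)$-determinacy means: for every continuous surjection $\pi:[T]\to X$ and every $E$-invariant set $A\subseteq X$ in $\boldsymbol{\Gamma}$, the game $G(\pi^{-1}(A),T)$ is determined, where in $G(\pi^{-1}(A),T)$ the players alternately play natural numbers, must keep the position in $T$ (the first player to make a move leaving $T$ loses), and if both always stay in $T$, player I wins iff the resulting branch lies in $\pi^{-1}(A)$. *)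

theory Defs
  imports "HOL-Analysis.Analysis" "HOL-Library.Sublist"
begin

definition polish_topology :: "'a topology \<Rightarrow> bool" where
  "polish_topology X \<longleftrightarrow> separable_space X \<and> completely_metrizable_space X"

text \<open>
  A pointclass is a collection of pairs \<open>(X, A)\<close>, read "\<open>A\<close> is a subset of the Polish space \<open>X\<close>
  belonging to the pointclass". The spaces range over all Polish topologies whose points lie in
  the type \<open>'a\<close>, with arbitrary carrier \<open>topspace X\<close>. As \<open>'a\<close> is arbitrary, it may be any type
  having at least continuum many elements, and then every Polish space has a homeomorphic copy
  among these.
\<close>
definition pointclass :: "('a topology \<times> 'a set) set \<Rightarrow> bool" where
  "pointclass \<Gamma> \<longleftrightarrow>
     (\<forall>(X, A) \<in> \<Gamma>. polish_topology X \<and> A \<subseteq> topspace X) \<and>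
     (\<forall>X Y f A. polish_topology X \<longrightarrow> (Y, A) \<in> \<Gamma> \<longrightarrow> continuous_map X Y f \<longrightarrow>
        (X, {x \<in> topspace X. f x \<in> A}) \<in> \<Gamma>)"

definition invariant_set :: "('a \<times> 'a) set \<Rightarrow> 'a set \<Rightarrow> bool" where
  "invariant_set E A \<longleftrightarrow> (\<forall>(x, y) \<in> E. x \<in> A \<longrightarrow> y \<in> A)"

definition baire_space :: "(nat \<Rightarrow> nat) topology" where
  "baire_space = product_topology (\<lambda>_. discrete_topology UNIV) UNIV"

definition initial_segment :: "(nat \<Rightarrow> nat) \<Rightarrow> nat \<Rightarrow> nat list" where
  "initial_segment x n = map x [0..<n]"

text \<open>
  Player I makes the moves \<open>x 0, x 2, \<dots>\<close> and player II the moves \<open>x 1, x 3, \<dots>\<close>. A strategy is a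
  function on all positions; only its values at positions where its owner is to move matter.
\<close>
definition follows_I :: "(nat list \<Rightarrow> nat) \<Rightarrow> (nat \<Rightarrow> nat) \<Rightarrow> bool" where
  "follows_I \<sigma> x \<longleftrightarrow> (\<forall>n. even n \<longrightarrow> x n = \<sigma> (initial_segment x n))"

definition follows_II :: "(nat list \<Rightarrow> nat) \<Rightarrow> (nat \<Rightarrow> nat) \<Rightarrow> bool" where
  "follows_II \<tau> x \<longleftrightarrow> (\<forall>n. odd n \<longrightarrow> x n = \<tau> (initial_segment x n))"

text \<open>The argument \<open>W\<close> is the set of plays won by player I.\<close>
definition determined :: "(nat \<Rightarrow> nat) set \<Rightarrow> bool" where
  "determined W \<longleftrightarrow>
     (\<exists>\<sigma>. \<forall>x. follows_I \<sigma> x \<longrightarrow> x \<in> W) \<or> (\<exists>\<tau>. \<forall>x. follows_II \<tau> x \<longrightarrow> x \<notin> W)"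

definition is_tree :: "nat list set \<Rightarrow> bool" where
  "is_tree T \<longleftrightarrow> (\<forall>t \<in> T. \<forall>s. prefix s t \<longrightarrow> s \<in> T)"

definition pruned_tree :: "nat list set \<Rightarrow> bool" where
  "pruned_tree T \<longleftrightarrow> is_tree T \<and> (\<forall>s \<in> T. \<exists>t \<in> T. strict_prefix s t)"

definition branches :: "nat list set \<Rightarrow> (nat \<Rightarrow> nat) set" where
  "branches T = {x. \<forall>n. initial_segment x n \<in> T}"

text \<open>
  The plays won by player I in \<open>G(B, T)\<close>. The move with index \<open>n\<close> leads to the position
  \<open>initial_segment x (Suc n)\<close>, so the \<open>LEAST\<close> term is the index of the first move leaving \<open>T\<close>; that
  move is made by player II iff its index is odd.
\<close>
definition tree_game :: "(nat \<Rightarrow> nat) set \<Rightarrow> nat list set \<Rightarrow> (nat \<Rightarrow> nat) set" where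
  "tree_game B T =
     {x. if x \<in> branches T then x \<in> B else odd (LEAST n. initial_segment x (Suc n) \<notin> T)}"

definition determinacy ::
  "('a topology \<times> 'a set) set \<Rightarrow> 'a topology \<Rightarrow> ('a \<times> 'a) set \<Rightarrow> bool" where
  "determinacy \<Gamma> X E \<longleftrightarrow>
     (\<forall>\<pi> A. continuous_map baire_space X \<pi> \<and> \<pi> ` topspace baire_space = topspace X \<and>
        (X, A) \<in> \<Gamma> \<and> invariant_set E A \<longrightarrow>
        determined {x \<in> topspace baire_space. \<pi> x \<in> A})"

definition tree_determinacy ::
  "('a topology \<times> 'a set) set \<Rightarrow> 'a topology \<Rightarrow> ('a \<times> 'a) set \<Rightarrow> nat list set \<Rightarrow> bool" where
  "tree_determinacy \<Gamma> X E T \<longleftrightarrow>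
     (\<forall>\<pi> A. continuous_map (subtopology baire_space (branches T)) X \<pi> \<and>
        \<pi> ` branches T = topspace X \<and> (X, A) \<in> \<Gamma> \<and> invariant_set E A \<longrightarrow>
        determined (tree_game {x \<in> branches T. \<pi> x \<in> A} T))"

end

theory Submission
  imports Defs
begin

text \<open>
  Replacing every illegal move of a play by the least legal one defines a continuous retraction
  \<open>r\<close> of Baire space onto \<open>[T]\<close>, so \<open>\<pi> \<circ> r\<close> is a continuous surjection from Baire space and the
  game with payoff \<open>(\<pi> \<circ> r)\<^sup>-\<^sup>1(A)\<close> is determined. A winning strategy in that game is transferred to
  the game on \<open>T\<close>: its owner keeps an auxiliary play that contains the uncorrected answers of the
  given strategy and the actual moves of the opponent, and plays the corrected answers on \<open>T\<close>.
  As long as the opponent stays in \<open>T\<close>, the auxiliary play is mapped by \<open>r\<close> to the actual one.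
\<close>

lemma initial_segment_0 [simp]: "initial_segment x 0 = []"
  by (simp add: initial_segment_def)

lemma initial_segment_Suc: "initial_segment x (Suc n) = initial_segment x n @ [x n]"
  by (simp add: initial_segment_def)

lemma length_initial_segment [simp]: "length (initial_segment x n) = n"
  by (simp add: initial_segment_def)

lemma topspace_baire_space [simp]: "topspace baire_space = UNIV"
  by (simp add: baire_space_def)

lemma continuous_map_initial_segment:
  "continuous_map baire_space (discrete_topology UNIV) (\<lambda>x. initial_segment x n)"
proof (induction n)
  case 0
  then show ?case
    by simp
next
  case (Suc n)
  have "continuous_map baire_space (discrete_topology UNIV) (\<lambda>x. x n)"
    unfolding baire_space_def by (rule continuous_map_product_projection) simp
  with Suc have "continuous_map baire_space (discrete_topology (UNIV \<times> UNIV))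
      (\<lambda>x. (initial_segment x n, x n))"
    unfolding prod_topology_discrete_topology by (rule continuous_map_pairedI)
  from continuous_map_compose[OF this, of "discrete_topology UNIV" "\<lambda>(s, a). s @ [a]"]
  show ?case
    by (simp add: o_def initial_segment_Suc)
qed

definition revised_position :: "(nat list \<Rightarrow> nat \<Rightarrow> nat) \<Rightarrow> nat list \<Rightarrow> nat list" where
  "revised_position g = foldl (\<lambda>t a. t @ [g t a]) []"

definition revised_play :: "(nat list \<Rightarrow> nat \<Rightarrow> nat) \<Rightarrow> (nat \<Rightarrow> nat) \<Rightarrow> nat \<Rightarrow> nat" where
  "revised_play g x n = g (revised_position g (initial_segment x n)) (x n)"

lemma revised_position_Nil [simp]: "revised_position g [] = []"
  by (simp add: revised_position_def)

lemma revised_position_snoc [simp]: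
  "revised_position g (s @ [a]) = revised_position g s @ [g (revised_position g s) a]"
  by (simp add: revised_position_def)

lemma initial_segment_revised_play:
  "initial_segment (revised_play g x) n = revised_position g (initial_segment x n)"
  by (induction n) (simp_all add: initial_segment_Suc revised_play_def)

lemma revised_play_unfold:
  "revised_play g x n = g (initial_segment (revised_play g x) n) (x n)"
  by (simp add: initial_segment_revised_play) (simp add: revised_play_def)

lemma revised_play_eqI:
  assumes "\<And>n. g (initial_segment y n) (x n) = y n"
  shows "revised_play g x = y"
proof
  have "revised_position g (initial_segment x n) = initial_segment y n" for n
    by (induction n) (simp_all add: assms initial_segment_Suc)
  then show "revised_play g x n = y n" for n
    by (simp add: revised_play_def assms)
qed

lemma continuous_map_revised_play: "continuous_map baire_space baire_space (revised_play g)"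
proof -
  have "continuous_map baire_space (discrete_topology UNIV) (\<lambda>x. revised_play g x n)" for n
  proof -
    have "continuous_map baire_space (discrete_topology UNIV)
        ((\<lambda>s. last (revised_position g s)) \<circ> (\<lambda>x. initial_segment x (Suc n)))"
      by (rule continuous_map_compose[OF continuous_map_initial_segment]) simp
    then show ?thesis
      by (simp add: o_def initial_segment_Suc revised_play_def)
  qed
  then show ?thesis
    by (subst (2) baire_space_def) (simp add: continuous_map_componentwise_UNIV)
qed

definition correct_move :: "nat list set \<Rightarrow> nat list \<Rightarrow> nat \<Rightarrow> nat" where
  "correct_move T s a = (if s @ [a] \<in> T then a else (LEAST b. s @ [b] \<in> T))"

abbreviation corrected_play :: "nat list set \<Rightarrow> (nat \<Rightarrow> nat) \<Rightarrow> nat \<Rightarrow> nat" where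
  "corrected_play T \<equiv> revised_play (correct_move T)"

lemma is_tree_Nil: "is_tree T \<Longrightarrow> T \<noteq> {} \<Longrightarrow> [] \<in> T"
  by (auto simp: is_tree_def)

lemma pruned_tree_extension:
  assumes "pruned_tree T" "s \<in> T"
  obtains b where "s @ [b] \<in> T"
proof -
  obtain t where t: "t \<in> T" "strict_prefix s t"
    using assms by (auto simp: pruned_tree_def)
  then obtain b u where "t = s @ b # u"
    by (auto elim: strict_prefixE')
  then have "prefix (s @ [b]) t"
    by (simp add: prefix_def)
  with t(1) assms(1) show thesis
    by (auto simp: pruned_tree_def is_tree_def intro: that)
qed

lemma correct_move_in_tree:
  assumes "pruned_tree T" "s \<in> T"
  shows "s @ [correct_move T s a] \<in> T"
proof -
  obtain b where "s @ [b] \<in> T"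
    using assms by (rule pruned_tree_extension)
  then show ?thesis
    by (auto simp: correct_move_def intro: LeastI)
qed

lemma correct_move_branch:
  assumes "x \<in> branches T"
  shows "correct_move T (initial_segment x n) (x n) = x n"
proof -
  have "initial_segment x n @ [x n] \<in> T"
    using assms by (auto simp: branches_def simp flip: initial_segment_Suc)
  then show ?thesis
    by (simp add: correct_move_def)
qed

lemma corrected_play_in_branches:
  assumes "pruned_tree T" "[] \<in> T"
  shows "corrected_play T x \<in> branches T"
proof -
  have "revised_position (correct_move T) (initial_segment x n) \<in> T" for n
    by (induction n) (simp_all add: assms correct_move_in_tree initial_segment_Suc)
  then show ?thesis
    by (simp add: branches_def initial_segment_revised_play)
qed

lemma corrected_play_branch: "x \<in> branches T \<Longrightarrow> corrected_play T x = x"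
  by (intro revised_play_eqI correct_move_branch)

lemma retraction_maps_corrected_play:
  assumes "pruned_tree T" "[] \<in> T"
  shows "retraction_maps baire_space (subtopology baire_space (branches T)) (corrected_play T) id"
  by (auto simp: retraction_maps_def continuous_map_in_subtopology continuous_map_revised_play
      corrected_play_in_branches[OF assms] corrected_play_branch
      intro: continuous_map_from_subtopology)

text \<open>The predicate \<open>P\<close> holds of the indices of the moves made by the owner of the strategy.\<close>

definition follows_on :: "(nat \<Rightarrow> bool) \<Rightarrow> (nat list \<Rightarrow> nat) \<Rightarrow> (nat \<Rightarrow> nat) \<Rightarrow> bool" where
  "follows_on P \<sigma> x \<longleftrightarrow> (\<forall>n. P n \<longrightarrow> x n = \<sigma> (initial_segment x n))"

lemma follows_I_eq_follows_on: "follows_I = follows_on even"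
  by (simp add: fun_eq_iff follows_I_def follows_on_def)

lemma follows_II_eq_follows_on: "follows_II = follows_on odd"
  by (simp add: fun_eq_iff follows_II_def follows_on_def)

definition override_move ::
  "(nat \<Rightarrow> bool) \<Rightarrow> (nat list \<Rightarrow> nat) \<Rightarrow> nat list \<Rightarrow> nat \<Rightarrow> nat" where
  "override_move P \<sigma> s a = (if P (length s) then \<sigma> s else a)"

lemma follows_on_revised_play_override: "follows_on P \<sigma> (revised_play (override_move P \<sigma>) x)"
  by (simp add: follows_on_def override_move_def revised_play_unfold[of _ x])

definition transferred_strategy ::
  "nat list set \<Rightarrow> (nat \<Rightarrow> bool) \<Rightarrow> (nat list \<Rightarrow> nat) \<Rightarrow> nat list \<Rightarrow> nat" where
  "transferred_strategy T P \<sigma> s =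
     correct_move T s (\<sigma> (revised_position (override_move P \<sigma>) s))"

lemma transferred_strategy_in_tree:
  assumes "pruned_tree T" "follows_on P (transferred_strategy T P \<sigma>) x"
    and "P n" "initial_segment x n \<in> T"
  shows "initial_segment x (Suc n) \<in> T"
  using assms correct_move_in_tree
  by (simp add: follows_on_def transferred_strategy_def initial_segment_Suc)

lemma corrected_play_override:
  assumes "follows_on P (transferred_strategy T P \<sigma>) x" "x \<in> branches T"
  shows "corrected_play T (revised_play (override_move P \<sigma>) x) = x"
proof (rule revised_play_eqI)
  fix n
  let ?z = "revised_play (override_move P \<sigma>) x"
  show "correct_move T (initial_segment x n) (?z n) = x n"
  proof (cases "P n")
    case True
    have "?z n = \<sigma> (revised_position (override_move P \<sigma>) (initial_segment x n))"
      using True by (simp add: revised_play_unfold[of _ x] override_move_def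
          flip: initial_segment_revised_play)
    then show ?thesis
      using assms(1) True by (simp add: follows_on_def transferred_strategy_def)
  next
    case False
    then have "?z n = x n"
      by (simp add: revised_play_unfold[of _ x] override_move_def)
    then show ?thesis
      by (simp add: correct_move_branch assms(2))
  qed
qed

definition exit_index :: "nat list set \<Rightarrow> (nat \<Rightarrow> nat) \<Rightarrow> nat" where
  "exit_index T x = (LEAST n. initial_segment x (Suc n) \<notin> T)"

lemma tree_game_branch: "x \<in> branches T \<Longrightarrow> x \<in> tree_game B T \<longleftrightarrow> x \<in> B"
  by (simp add: tree_game_def)

lemma tree_game_exit: "x \<notin> branches T \<Longrightarrow> x \<in> tree_game B T \<longleftrightarrow> odd (exit_index T x)"
  by (simp add: tree_game_def exit_index_def)

lemma initial_segment_exit_index: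
  assumes "[] \<in> T"
  shows "initial_segment x (exit_index T x) \<in> T"
proof (cases "exit_index T x")
  case 0
  with assms show ?thesis
    by simp
next
  case (Suc j)
  then have "j < exit_index T x"
    by simp
  then have "initial_segment x (Suc j) \<in> T"
    unfolding exit_index_def using not_less_Least by blast
  with Suc show ?thesis
    by simp
qed

lemma initial_segment_Suc_exit_index:
  assumes "[] \<in> T" "x \<notin> branches T"
  shows "initial_segment x (Suc (exit_index T x)) \<notin> T"
proof -
  obtain m where "initial_segment x m \<notin> T"
    using assms(2) by (auto simp: branches_def)
  with assms(1) obtain k where "initial_segment x (Suc k) \<notin> T"
    by (cases m) auto
  then show ?thesis
    unfolding exit_index_def by (rule LeastI)
qed

lemma transferred_strategy_cases:
  assumes "pruned_tree T" "[] \<in> T" "follows_on P (transferred_strategy T P \<sigma>) x"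
  obtains (branch) z where "x \<in> branches T" "follows_on P \<sigma> z" "corrected_play T z = x"
    | (exit) "x \<notin> branches T" "\<not> P (exit_index T x)"
proof (cases "x \<in> branches T")
  case True
  then show thesis
    using branch corrected_play_override[OF assms(3)] follows_on_revised_play_override by blast
next
  case False
  then show thesis
    using exit transferred_strategy_in_tree[OF assms(1,3)]
      initial_segment_exit_index[OF assms(2)] initial_segment_Suc_exit_index[OF assms(2)]
    by blast
qed

lemma determined_tree_game_empty: "determined (tree_game B {})"
proof -
  have "x \<notin> tree_game B {}" for x
    by (simp add: tree_game_def branches_def)
  then show ?thesis
    by (simp add: determined_def)
qed

lemma determined_tree_game:
  assumes T: "pruned_tree T" "[] \<in> T" and "determined {x. corrected_play T x \<in> B}"
  shows "determined (tree_game B T)"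
proof -
  from assms(3) consider
      (I) \<sigma> where "\<And>x. follows_on even \<sigma> x \<Longrightarrow> corrected_play T x \<in> B"
    | (II) \<tau> where "\<And>x. follows_on odd \<tau> x \<Longrightarrow> corrected_play T x \<notin> B"
    by (auto simp: determined_def follows_I_eq_follows_on follows_II_eq_follows_on)
  then show ?thesis
  proof cases
    case I
    have "x \<in> tree_game B T" if "follows_on even (transferred_strategy T even \<sigma>) x" for x
      using T that
      by (cases rule: transferred_strategy_cases) (auto simp: tree_game_branch tree_game_exit I)
    then show ?thesis
      by (auto simp: determined_def follows_I_eq_follows_on)
  next
    case II
    have "x \<notin> tree_game B T" if "follows_on odd (transferred_strategy T odd \<tau>) x" for x
      using T that
      by (cases rule: transferred_strategy_cases) (auto simp: tree_game_branch tree_game_exit II)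
    then show ?thesis
      by (auto simp: determined_def follows_II_eq_follows_on)
  qed
qed

lemma determinacy_retraction:
  assumes "determinacy \<Gamma> X E" "retraction_maps baire_space Y r s"
    and "continuous_map Y X \<pi>" "\<pi> ` topspace Y = topspace X"
    and "(X, A) \<in> \<Gamma>" "invariant_set E A"
  shows "determined {x. \<pi> (r x) \<in> A}"
proof -
  have "retraction_map baire_space Y r"
    using assms(2) by (auto simp: retraction_map_def)
  then have "r ` topspace baire_space = topspace Y"
    by (rule retraction_imp_surjective_map)
  then have "(\<pi> \<circ> r) ` topspace baire_space = topspace X"
    using assms(4) by (simp only: image_comp[symmetric])
  moreover have "continuous_map baire_space X (\<pi> \<circ> r)"
    using assms(2,3) continuous_map_compose by (auto simp: retraction_maps_def)
  ultimately have "determined {x \<in> topspace baire_space. (\<pi> \<circ> r) x \<in> A}"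
    using assms(1,5,6) unfolding determinacy_def by blast
  then show ?thesis
    by simp
qed

theorem theorem5p3:
  fixes \<Gamma> :: "('a topology \<times> 'a set) set"
    and X :: "'a topology"
    and E :: "('a \<times> 'a) set"
  assumes "pointclass \<Gamma>"
    and "polish_topology X"
    and "equiv (topspace X) E"
    and "determinacy \<Gamma> X E"
  shows "\<forall>T. pruned_tree T \<longrightarrow> tree_determinacy \<Gamma> X E T"
proof (intro allI impI)
  fix T assume T: "pruned_tree T"
  have "determined (tree_game {x \<in> branches T. \<pi> x \<in> A} T)"
    if "continuous_map (subtopology baire_space (branches T)) X \<pi>"
      and "\<pi> ` branches T = topspace X" "(X, A) \<in> \<Gamma>" "invariant_set E A" for \<pi> A
  proof (cases "T = {}")
    case True
    then show ?thesis
      by (simp add: determined_tree_game_empty)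
  next
    case False
    with T have root: "[] \<in> T"
      by (simp add: pruned_tree_def is_tree_Nil)
    have "determined {x. \<pi> (corrected_play T x) \<in> A}"
      using determinacy_retraction[OF assms(4) retraction_maps_corrected_play[OF T root]] that
      by simp
    with T root show ?thesis
      by (simp add: determined_tree_game corrected_play_in_branches)
  qed
  then show "tree_determinacy \<Gamma> X E T"
    by (simp add: tree_determinacy_def)
qed

end
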